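(* Let $m\ge1$ and let $t_1, \ldots, t_m$ and $r_1, \ldots, r_m$ be integers satisfying $t_i > r_i \geq 0$ for each $i \in [m]$. Let $M$ be a block matrix with $m$ square diagonal blocks, such that for each $i \in [m]$ the $i$th diagonal block of $M$ belongs to $\mathcal{M}_{t_i,r_i}$, and all of whose other entries (outside the diagonal blocks) are ones. Then \[\mathrm{rank}_{\mathrm{bin}}(M) \leq \sum_{i =1}^{m}{(t_i-r_i)} + \max_{i \in [m]}{r_i}.\]
   Context: For integers $t > r \geq 0$, $\mathcal{M}_{t,r}$ is the collection of all $0,1$ matrices $A$ of dimensions $n \times n$ (for some $n \geq 1$) for which there exist sets $A_1, \ldots, A_t \subseteq [n]$ (of rows) and $B_1, \ldots, B_t \subseteq [n]$ (of columns) such that: (1) the combinatorial rectangles $A_1 \times B_1, \ldots, A_t \times B_t$ form a partition of the ones in $A$; (2) the sets $A_1, \ldots, A_r$ are pairwise disjoint; (3) there exists a set $L \subseteq [t] \setminus [r]$ for which the sets $B_l$ with $l \in L$ form a partition of $[n]$; (4) for every $s \in [r]$, there exists a set $L_s \subseteq [t] \setminus [r]$ for which the sets $B_l$ with $l \in L_s$ form a partition of $[n] \setminus B_s$. The binary rank $\mathrm{rank}_{\mathrm{bin}}(A)$ of a $0,1$ matrix $A$ is the smallest number of combinatorial rectangles (all-one submatrices indexed by a set of rows times a set of columns) that partition the ones of $A$. *)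

theory Defs
  imports "Jordan_Normal_Form.Matrix" "HOL-Library.Disjoint_Sets"
begin

text \<open>
  The rows and columns of an \<open>n \<times> n\<close> matrix are indexed by \<open>{..<n}\<close>, as usual for the type
  \<^typ>\<open>'a mat\<close>; every other index set \<open>[k]\<close> is rendered as \<open>{1..k}\<close>.
\<close>

definition zero_one_mat :: "nat mat \<Rightarrow> bool" where
  "zero_one_mat M \<longleftrightarrow> elements_mat M \<subseteq> {0, 1}"

definition ones :: "nat mat \<Rightarrow> (nat \<times> nat) set" where
  "ones M = {(i, j). i < dim_row M \<and> j < dim_col M \<and> M $$ (i, j) = 1}"

text \<open>
  Partitions are indexed families of pairwise disjoint sets with the given union. In contrast to
  \<^const>\<open>partition_on\<close>, members of the family may be empty.
\<close>

definition family_partition :: "'i set \<Rightarrow> ('i \<Rightarrow> 'a set) \<Rightarrow> 'a set \<Rightarrow> bool" where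
  "family_partition I F S \<longleftrightarrow> disjoint_family_on F I \<and> (\<Union>i\<in>I. F i) = S"

definition rectangle_partition ::
    "nat mat \<Rightarrow> nat \<Rightarrow> (nat \<Rightarrow> nat set) \<Rightarrow> (nat \<Rightarrow> nat set) \<Rightarrow> bool" where
  "rectangle_partition M k A B \<longleftrightarrow>
     (\<forall>l\<in>{1..k}. A l \<subseteq> {..<dim_row M} \<and> B l \<subseteq> {..<dim_col M}) \<and>
     family_partition {1..k} (\<lambda>l. A l \<times> B l) (ones M)"

definition rank_bin :: "nat mat \<Rightarrow> nat" where
  "rank_bin M = (LEAST k. \<exists>A B. rectangle_partition M k A B)"

text \<open>The minimum in \<^const>\<open>rank_bin\<close> is attained: the ones can be covered by singletons.\<close>

lemma rectangle_partition_exists: "\<exists>k A B. rectangle_partition M k A B"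
proof -
  let ?K = "{1..card (ones M)}"
  have "ones M \<subseteq> {..<dim_row M} \<times> {..<dim_col M}"
    unfolding ones_def by blast
  then have "finite (ones M)"
    by (rule finite_subset) simp
  then obtain h where h: "bij_betw h ?K (ones M)"
    using ex_bij_betw_nat_finite_1 by blast
  have sing: "{fst (h l)} \<times> {snd (h l)} = {h l}" for l
    by (cases "h l") simp
  have bounds: "{fst (h l)} \<subseteq> {..<dim_row M} \<and> {snd (h l)} \<subseteq> {..<dim_col M}" if "l \<in> ?K" for l
  proof -
    have "h l \<in> ones M"
      using h that by (rule bij_betw_apply)
    then show ?thesis
      unfolding ones_def by (cases "h l") simp
  qed
  have "disjoint_family_on (\<lambda>l. {h l}) ?K"
    unfolding disjoint_family_on_def using bij_betw_imp_inj_on[OF h] by (blast dest: inj_onD)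
  moreover have "(\<Union>l\<in>?K. {h l}) = ones M"
    using bij_betw_imp_surj_on[OF h] by blast
  ultimately have "family_partition ?K (\<lambda>l. {h l}) (ones M)"
    unfolding family_partition_def by (rule conjI)
  then have "rectangle_partition M (card (ones M)) (\<lambda>l. {fst (h l)}) (\<lambda>l. {snd (h l)})"
    unfolding rectangle_partition_def sing using bounds by blast
  then show ?thesis by blast
qed

definition matrix_class :: "nat \<Rightarrow> nat \<Rightarrow> nat mat set" where
  "matrix_class t r = {M. \<exists>n\<ge>1. M \<in> carrier_mat n n \<and> zero_one_mat M \<and>
     (\<exists>A B. rectangle_partition M t A B \<and>
        disjoint_family_on A {1..r} \<and>
        (\<exists>L. L \<subseteq> {1..t} - {1..r} \<and> family_partition L B {..<n}) \<and>
        (\<forall>s\<in>{1..r}. \<exists>L. L \<subseteq> {1..t} - {1..r} \<and> family_partition L B ({..<n} - B s)))}"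

text \<open>
  For a block matrix whose diagonal blocks have sizes \<open>n 1, \<dots>, n m\<close>, the block row (and block
  column) \<open>i\<close> starts at index \<open>block_start n i\<close>.
\<close>

definition block_start :: "(nat \<Rightarrow> nat) \<Rightarrow> nat \<Rightarrow> nat" where
  "block_start n i = (\<Sum>k\<in>{1..<i}. n k)"

definition block :: "(nat \<Rightarrow> nat) \<Rightarrow> nat mat \<Rightarrow> nat \<Rightarrow> nat \<Rightarrow> nat mat" where
  "block n M i j =
     mat (n i) (n j) (\<lambda>(a, b). M $$ (block_start n i + a, block_start n j + b))"

end

theory Submission
  imports Defs
begin

text \<open>
  In each block, a row lies in at most one of the disjoint sets \<open>A\<^sub>1, \<dots>, A\<^sub>r\<close>; call its index the
  colour of the row, with colour 0 if there is none. For each colour \<open>s \<ge> 1\<close> the rectangles number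
  \<open>s\<close> of all blocks are merged into a single rectangle, whose rows are all rows of colour \<open>s\<close>;
  this yields \<open>max r\<^sub>i\<close> rectangles. In an off-diagonal block, the columns that remain uncovered in a
  row of colour \<open>s\<close> form the complement of \<open>B\<^sub>s\<close> (of the empty set for colour 0 or if the column
  block has no rectangle \<open>s\<close>), which conditions (3) and (4) split into sets \<open>B\<^sub>l\<close> with
  \<open>l > r\<close>. So it suffices to add this row to those rectangles \<open>A\<^sub>l \<times> B\<^sub>l\<close> of the column block.
\<close>

text \<open>Disjointness together with covering amounts to exactly one index per point, the form in
  which coverings of single entries are compared below.\<close>

lemma family_partition_iff:
  "family_partition I F S \<longleftrightarrow>
     (\<forall>i\<in>I. F i \<subseteq> S) \<and> (\<forall>x\<in>S. \<exists>!i. i \<in> I \<and> x \<in> F i)"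
proof
  assume "family_partition I F S"
  then have disj: "\<And>i j. i \<in> I \<Longrightarrow> j \<in> I \<Longrightarrow> i \<noteq> j \<Longrightarrow> F i \<inter> F j = {}" and S: "(\<Union>i\<in>I. F i) = S"
    unfolding family_partition_def disjoint_family_on_def by simp_all
  have "\<exists>!i. i \<in> I \<and> x \<in> F i" if "x \<in> S" for x
  proof -
    obtain i where "i \<in> I" "x \<in> F i" using \<open>x \<in> S\<close> S by blast
    then show ?thesis using disj by (intro ex1I[of _ i]) blast+
  qed
  then show "(\<forall>i\<in>I. F i \<subseteq> S) \<and> (\<forall>x\<in>S. \<exists>!i. i \<in> I \<and> x \<in> F i)"
    using S by blast
next
  assume rhs: "(\<forall>i\<in>I. F i \<subseteq> S) \<and> (\<forall>x\<in>S. \<exists>!i. i \<in> I \<and> x \<in> F i)"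
  then have sub: "\<And>i. i \<in> I \<Longrightarrow> F i \<subseteq> S" by blast
  have "F i \<inter> F j = {}" if ij: "i \<in> I" "j \<in> I" "i \<noteq> j" for i j
  proof (rule equals0I)
    fix x assume x: "x \<in> F i \<inter> F j"
    then have "\<exists>!i. i \<in> I \<and> x \<in> F i" using sub[OF ij(1)] rhs by blast
    then show False using x ij by (elim ex1E) blast
  qed
  moreover have "(\<Union>i\<in>I. F i) = S"
  proof
    show "S \<subseteq> (\<Union>i\<in>I. F i)" using rhs by (auto dest!: bspec ex1_implies_ex)
  qed (use sub in blast)
  ultimately show "family_partition I F S"
    unfolding family_partition_def disjoint_family_on_def by simp
qed

text \<open>Re-indexing along a bijection with \<open>{1..card I}\<close> admits any finite index
  set; the final rectangles are indexed by pairs.\<close>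

lemma rank_bin_le_card:
  assumes fin: "finite I"
    and sub: "\<And>i. i \<in> I \<Longrightarrow> A i \<subseteq> {..<dim_row M} \<and> B i \<subseteq> {..<dim_col M}"
    and part: "family_partition I (\<lambda>i. A i \<times> B i) (ones M)"
  shows "rank_bin M \<le> card I"
proof -
  obtain h where h: "bij_betw h {1..card I} I"
    using ex_bij_betw_nat_finite_1[OF fin] by blast
  have img: "h ` {1..card I} = I" and inj: "inj_on h {1..card I}"
    using h by (auto simp: bij_betw_def)
  have "disjoint_family_on (\<lambda>l. A (h l) \<times> B (h l)) {1..card I}"
    unfolding disjoint_family_on_def
  proof (intro ballI impI)
    fix x y assume xy: "x \<in> {1..card I}" "y \<in> {1..card I}" "x \<noteq> y"
    then have "h x \<noteq> h y" "h x \<in> I" "h y \<in> I"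
      using inj img by (auto dest: inj_onD)
    then show "A (h x) \<times> B (h x) \<inter> A (h y) \<times> B (h y) = {}"
      using part unfolding family_partition_def disjoint_family_on_def by blast
  qed
  moreover have "(\<Union>l\<in>{1..card I}. A (h l) \<times> B (h l)) = (\<Union>i\<in>h ` {1..card I}. A i \<times> B i)"
    by (simp only: image_image)
  then have "(\<Union>l\<in>{1..card I}. A (h l) \<times> B (h l)) = ones M"
    using part unfolding img family_partition_def by simp
  moreover have "\<forall>l\<in>{1..card I}. A (h l) \<subseteq> {..<dim_row M} \<and> B (h l) \<subseteq> {..<dim_col M}"
    using sub bij_betw_apply[OF h] by simp
  ultimately have "rectangle_partition M (card I) (\<lambda>l. A (h l)) (\<lambda>l. B (h l))"
    unfolding rectangle_partition_def family_partition_def by simp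
  then show ?thesis
    unfolding rank_bin_def by (intro Least_le) blast
qed

text \<open>
  Normal form of the class: \<open>c\<close> is the colouring of the rows, and the index 0 stands for the one
  rectangle among the first \<open>r\<close> ones that meets the row under consideration.
\<close>

lemma matrix_class_coloring:
  assumes "M \<in> matrix_class t r" and "r < t"
  obtains A B C :: "nat \<Rightarrow> nat set" and L :: "nat \<Rightarrow> nat set" and c :: "nat \<Rightarrow> nat"
  where "\<And>a. c a \<le> r" and "C 0 = {}"
    and "\<And>a b. a < dim_row M \<Longrightarrow> b < dim_row M \<Longrightarrow> M $$ (a, b) = 1 \<Longrightarrow>
           \<exists>!l. l \<in> insert 0 {r<..t} \<and> (if l = 0 then b \<in> C (c a) else a \<in> A l \<and> b \<in> B l)"
    and "\<And>a b l. a < dim_row M \<Longrightarrow> b < dim_row M \<Longrightarrow> l \<in> insert 0 {r<..t} \<Longrightarrow>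
           (if l = 0 then b \<in> C (c a) else a \<in> A l \<and> b \<in> B l) \<Longrightarrow> M $$ (a, b) = 1"
    and "\<And>s b. b < dim_row M \<Longrightarrow>
           \<exists>!l. l \<in> insert 0 {r<..t} \<and> (if l = 0 then b \<in> C s else l \<in> L s \<and> b \<in> B l)"
proof -
  obtain n A B where M: "M \<in> carrier_mat n n"
    and part: "rectangle_partition M t A B"
    and disj: "disjoint_family_on A {1..r}"
    and L0: "\<exists>L. L \<subseteq> {1..t} - {1..r} \<and> family_partition L B {..<n}"
    and L1: "\<forall>s\<in>{1..r}. \<exists>L. L \<subseteq> {1..t} - {1..r} \<and> family_partition L B ({..<n} - B s)"
    using assms(1) unfolding matrix_class_def by blast
  \<comment> \<open>The default \<open>{}\<close> turns condition (3) into the instance of (4) for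
    colour 0 and for colours above \<open>r\<close>, which rows of other blocks may have.\<close>
  define C where "C s = (if s \<in> {1..r} then B s else {})" for s
  have "\<exists>L. L \<subseteq> {r<..t} \<and> family_partition L B ({..<n} - C s)" for s
  proof -
    have "{1..t} - {1..r} = {r<..t}" by auto
    then show ?thesis
      using L0 L1 unfolding C_def by (cases "s \<in> {1..r}") auto
  qed
  then obtain L where L: "\<And>s. L s \<subseteq> {r<..t}"
    and LB: "\<And>s. family_partition (L s) B ({..<n} - C s)"
    by metis
  \<comment> \<open>Disjointness of the first \<open>r\<close> row sets makes the description
    unique; 0 marks a row outside all of them.\<close>
  define c where "c a = (if \<exists>s\<in>{1..r}. a \<in> A s then THE s. s \<in> {1..r} \<and> a \<in> A s else 0)" for a
  have c_eq: "c a = s" if "s \<in> {1..r}" "a \<in> A s" for a s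
  proof -
    have "(THE s. s \<in> {1..r} \<and> a \<in> A s) = s"
      using that disj unfolding disjoint_family_on_def by blast
    then show ?thesis
      using that unfolding c_def by auto
  qed
  have c_cases: "c a = 0 \<and> (\<forall>s\<in>{1..r}. a \<notin> A s) \<or> c a \<in> {1..r} \<and> a \<in> A (c a)" for a
  proof (cases "\<exists>s\<in>{1..r}. a \<in> A s")
    case True
    then show ?thesis using c_eq by blast
  next
    case False
    then show ?thesis unfolding c_def by auto
  qed
  have c_le: "c a \<le> r" for a
    using c_cases[of a] by auto
  have C_iff: "b \<in> C (c a) \<longleftrightarrow> c a \<in> {1..r} \<and> a \<in> A (c a) \<and> b \<in> B (c a)" for a b
    using c_cases[of a] unfolding C_def by auto
  have dims: "dim_row M = n" "dim_col M = n"
    using M by auto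
  have rect: "A l \<times> B l \<subseteq> ones M" if "l \<in> {1..t}" for l
    using part that unfolding rectangle_partition_def family_partition_iff by blast
  show thesis
  proof
    show "c a \<le> r" for a by (rule c_le)
    show "C 0 = {}" by (simp add: C_def)
  next
    fix a b assume ab: "a < dim_row M" "b < dim_row M" "M $$ (a, b) = 1"
    then have "(a, b) \<in> ones M"
      by (simp add: ones_def dims)
    then have "\<exists>!l. l \<in> {1..t} \<and> (a, b) \<in> A l \<times> B l"
      using part unfolding rectangle_partition_def family_partition_iff by blast
    then obtain l where l: "l \<in> {1..t}" "a \<in> A l" "b \<in> B l"
      and uniq: "\<And>k. k \<in> {1..t} \<Longrightarrow> a \<in> A k \<Longrightarrow> b \<in> B k \<Longrightarrow> k = l"
      by (elim ex1E) blast
    show "\<exists>!l. l \<in> insert 0 {r<..t} \<and> (if l = 0 then b \<in> C (c a) else a \<in> A l \<and> b \<in> B l)"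
    proof (cases "l \<le> r")
      case True
      \<comment> \<open>A covering rectangle among the first \<open>r\<close> carries the colour of
        row \<open>a\<close>, so index 0 represents it.\<close>
      then have "c a = l" using l c_eq by auto
      show ?thesis
      proof (rule ex1I[of _ 0])
        show "0 \<in> insert 0 {r<..t} \<and> (if (0::nat) = 0 then b \<in> C (c a) else a \<in> A 0 \<and> b \<in> B 0)"
          using True l \<open>c a = l\<close> by (simp add: C_def)
      next
        fix k assume "k \<in> insert 0 {r<..t} \<and> (if k = 0 then b \<in> C (c a) else a \<in> A k \<and> b \<in> B k)"
        then show "k = 0"
          using uniq[of k] True by (auto split: if_splits)
      qed
    next
      case False
      show ?thesis
      proof (rule ex1I[of _ l])
        show "l \<in> insert 0 {r<..t} \<and> (if l = 0 then b \<in> C (c a) else a \<in> A l \<and> b \<in> B l)"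
          using False l by auto
      next
        fix k assume k: "k \<in> insert 0 {r<..t} \<and> (if k = 0 then b \<in> C (c a) else a \<in> A k \<and> b \<in> B k)"
        \<comment> \<open>Otherwise rectangle \<open>c a\<close>, which differs from
          \<open>l\<close> because \<open>l > r\<close>, would also cover the entry.\<close>
        have "b \<notin> C (c a)"
          using uniq[of "c a"] False \<open>r < t\<close> by (auto simp: C_iff)
        then show "k = l"
          using k uniq[of k] by (auto split: if_splits)
      qed
    qed
  next
    fix a b l
    assume "a < dim_row M" "b < dim_row M" "l \<in> insert 0 {r<..t}"
      "if l = 0 then b \<in> C (c a) else a \<in> A l \<and> b \<in> B l"
    then have "\<exists>k\<in>{1..t}. a \<in> A k \<and> b \<in> B k"
      using \<open>r < t\<close> by (force simp: C_iff split: if_splits)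
    then show "M $$ (a, b) = 1"
      using rect unfolding ones_def by blast
  next
    fix s b assume b: "b < dim_row M"
    \<comment> \<open>This keeps the marker 0 apart from the genuine rectangle indices in
      \<open>L s\<close>.\<close>
    have L_pos: "0 \<notin> L s" using L[of s] by auto
    show "\<exists>!l. l \<in> insert 0 {r<..t} \<and> (if l = 0 then b \<in> C s else l \<in> L s \<and> b \<in> B l)"
    proof (cases "b \<in> C s")
      case True
      then have "b \<notin> B l" if "l \<in> L s" for l
        using LB[of s] that unfolding family_partition_iff by blast
      then show ?thesis
        using True by (intro ex1I[of _ 0]) (auto split: if_splits)
    next
      case False
      then have "\<exists>!l. l \<in> L s \<and> b \<in> B l"
        using LB[of s] b unfolding family_partition_iff dims by blast
      then show ?thesis
        using False L[of s] L_pos by (smt (verit, best) insertCI subsetD)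
    qed
  qed
qed

text \<open>The blocks occupy consecutive intervals, and the last one starts at the sum of the
  preceding sizes; hence induction on \<open>m\<close>.\<close>

lemma block_position:
  assumes "p < (\<Sum>i\<in>{1..m}. n i)"
  shows "\<exists>i a. i \<in> {1..m} \<and> a < n i \<and> p = block_start n i + a"
  using assms
proof (induction m)
  case (Suc m)
  have start: "block_start n (Suc m) = (\<Sum>i\<in>{1..m}. n i)"
    unfolding block_start_def by (simp add: atLeastLessThanSuc_atLeastAtMost)
  show ?case
  proof (cases "p < (\<Sum>i\<in>{1..m}. n i)")
    case True
    then obtain i a where "i \<in> {1..m}" "a < n i" "p = block_start n i + a"
      using Suc.IH by blast
    then show ?thesis
      by (intro exI[of _ i] exI[of _ a]) auto
  next
    case False
    with Suc.prems have "p - block_start n (Suc m) < n (Suc m)"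
      "p = block_start n (Suc m) + (p - block_start n (Suc m))"
      unfolding start by auto
    then show ?thesis
      by (intro exI[of _ "Suc m"] exI[of _ "p - block_start n (Suc m)"]) auto
  qed
qed simp

theorem theorem3p2:
  fixes m :: nat and t r n :: "nat \<Rightarrow> nat" and M :: "nat mat"
  assumes "m \<ge> 1"
    and "\<And>i. i \<in> {1..m} \<Longrightarrow> r i < t i"
    and "M \<in> carrier_mat (\<Sum>i\<in>{1..m}. n i) (\<Sum>i\<in>{1..m}. n i)"
    and "\<And>i. i \<in> {1..m} \<Longrightarrow> block n M i i \<in> matrix_class (t i) (r i)"
    and "\<And>i j. i \<in> {1..m} \<Longrightarrow> j \<in> {1..m} \<Longrightarrow> i \<noteq> j \<Longrightarrow>
           block n M i j = mat (n i) (n j) (\<lambda>_. 1)"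
  shows "rank_bin M \<le> (\<Sum>i\<in>{1..m}. t i - r i) + Max (r ` {1..m})"
proof -
  define N where "N = (\<Sum>i\<in>{1..m}. n i)"
  define R where "R = Max (r ` {1..m})"
  have r_le: "r i \<le> R" if "i \<in> {1..m}" for i
    using that unfolding R_def by simp
  have dims: "dim_row M = N" "dim_col M = N"
    using assms(3) unfolding N_def by auto
  have "\<forall>p. \<exists>i a. p < N \<longrightarrow> i \<in> {1..m} \<and> a < n i \<and> p = block_start n i + a"
    using block_position unfolding N_def by blast
  then obtain blk off where pos: "\<And>p. p < N \<Longrightarrow>
      blk p \<in> {1..m} \<and> off p < n (blk p) \<and> p = block_start n (blk p) + off p"
    by metis
  have entry: "M $$ (p, q) = block n M (blk p) (blk q) $$ (off p, off q)" if "p < N" "q < N" for p q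
    using pos[OF that(1)] pos[OF that(2)] unfolding block_def by simp
  \<comment> \<open>Bundling the properties supplied by \<open>matrix_class_coloring\<close> lets
    all five witnesses be chosen at once as functions of the block.\<close>
  define nice where "nice i A B C L c \<longleftrightarrow>
      (\<forall>a. c a \<le> r i) \<and> C 0 = {} \<and>
      (\<forall>a b. a < n i \<longrightarrow> b < n i \<longrightarrow> block n M i i $$ (a, b) = 1 \<longrightarrow>
        (\<exists>!l. l \<in> insert 0 {r i<..t i} \<and> (if l = 0 then b \<in> C (c a) else a \<in> A l \<and> b \<in> B l))) \<and>
      (\<forall>a b l. a < n i \<longrightarrow> b < n i \<longrightarrow> l \<in> insert 0 {r i<..t i} \<longrightarrow>
        (if l = 0 then b \<in> C (c a) else a \<in> A l \<and> b \<in> B l) \<longrightarrow> block n M i i $$ (a, b) = 1) \<and>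
      (\<forall>s b. b < n i \<longrightarrow>
        (\<exists>!l. l \<in> insert 0 {r i<..t i} \<and> (if l = 0 then b \<in> C s else l \<in> L s \<and> b \<in> B l)))"
    for i A B C L and c :: "nat \<Rightarrow> nat"
  have "\<exists>A B C L c. nice i A B C L c" if i: "i \<in> {1..m}" for i
  proof -
    have d: "dim_row (block n M i i) = n i" by (simp add: block_def)
    show ?thesis
      by (rule matrix_class_coloring[OF assms(4)[OF i] assms(2)[OF i], unfolded d])
        (unfold nice_def, blast)
  qed
  then obtain A B C L c where nice: "\<And>i. i \<in> {1..m} \<Longrightarrow> nice i (A i) (B i) (C i) (L i) (c i)"
    by metis
  \<comment> \<open>Colours of different blocks share the same numbers; this is what allows merging
    across blocks.\<close>
  define col where "col p = c (blk p) (off p)" for p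
  have col_le: "col p \<le> R" if "p < N" for p
    using nice pos[OF that] r_le unfolding nice_def col_def by (meson order_trans)
  text \<open>\<open>hit p q l\<close>: entry \<open>(p, q)\<close> is covered by the extended rectangle \<open>l\<close> of its
    column block, or, if \<open>l = 0\<close>, by a merged one.\<close>
  define hit where "hit p q l \<longleftrightarrow> (if l = 0 then off q \<in> C (blk q) (col p)
      else (if blk p = blk q then off p \<in> A (blk q) l else l \<in> L (blk q) (col p)) \<and>
        off q \<in> B (blk q) l)" for p q l
  define K where "K q = insert 0 {r (blk q)<..t (blk q)}" for q
  have hit_unique: "\<exists>!l. l \<in> K q \<and> hit p q l"
    if "p < N" "q < N" "M $$ (p, q) = 1" for p q
  proof -
    have q: "nice (blk q) (A (blk q)) (B (blk q)) (C (blk q)) (L (blk q)) (c (blk q))"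
      "off q < n (blk q)"
      using nice pos[OF that(2)] by blast+
    show ?thesis
    proof (cases "blk p = blk q")
      case True
      then have "off p < n (blk q)" "block n M (blk q) (blk q) $$ (off p, off q) = 1"
        using pos[OF that(1)] that(3) entry[OF that(1,2)] by simp_all
      then show ?thesis
        using q True unfolding nice_def hit_def K_def col_def by (simp only: simp_thms if_True)
    next
      \<comment> \<open>The last clause of \<open>nice\<close> holds for every colour, hence for
        \<open>col p\<close>, although this colour comes from another block and may exceed
        \<open>r (blk q)\<close>.\<close>
      case False
      then show ?thesis
        using q unfolding nice_def hit_def K_def by (simp only: if_False)
    qed
  qed
  have hit_one: "M $$ (p, q) = 1" if "p < N" "q < N" "l \<in> K q" "hit p q l" for p q l
  proof (cases "blk p = blk q")
    case True
    have "nice (blk q) (A (blk q)) (B (blk q)) (C (blk q)) (L (blk q)) (c (blk q))"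
      using nice pos[OF that(2)] by blast
    then have one: "block n M (blk q) (blk q) $$ (a, b) = 1"
      if "a < n (blk q)" "b < n (blk q)" "k \<in> K q"
        "if k = 0 then b \<in> C (blk q) (c (blk q) a) else a \<in> A (blk q) k \<and> b \<in> B (blk q) k"
      for a b k
      using that unfolding nice_def K_def by blast
    have "block n M (blk q) (blk q) $$ (off p, off q) = 1"
    proof (rule one[OF _ _ that(3)])
      show "off p < n (blk q)" "off q < n (blk q)"
        using pos[OF that(1)] pos[OF that(2)] True by metis+
      show "if l = 0 then off q \<in> C (blk q) (c (blk q) (off p))
          else off p \<in> A (blk q) l \<and> off q \<in> B (blk q) l"
        using that(4) True unfolding hit_def col_def by (cases "l = 0") simp_all
    qed
    then show ?thesis
      using True entry[OF that(1,2)] by simp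
  next
    case False
    then show ?thesis
      using assms(5)[of "blk p" "blk q"] pos[OF that(1)] pos[OF that(2)] entry[OF that(1,2)] by simp
  qed
  text \<open>Blocks are numbered from 1, so the pairs \<open>(0, s)\<close> are free for the merged rectangles.\<close>
  define I where "I = {0::nat} \<times> {1..R} \<union> (SIGMA i:{1..m}. {r i<..t i})"
  \<comment> \<open>For fixed \<open>i\<close> and \<open>l\<close>, the conditions of
    \<open>hit\<close> separate into one on \<open>p\<close> and one on \<open>q\<close>. For
    \<open>i = 0\<close> this works because \<open>p\<close> enters only through its colour, which
    is fixed to \<open>l\<close>.\<close>
  define rows where "rows = (\<lambda>(i, l). {p. p < N \<and> (if i = 0 then col p = l
      else if blk p = i then off p \<in> A i l else l \<in> L i (col p))})"
  define cols where "cols = (\<lambda>(i, l). {q. q < N \<and> (if i = 0 then off q \<in> C (blk q) l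
      else blk q = i \<and> off q \<in> B i l)})"
  \<comment> \<open>Translates an index local to the column block of \<open>q\<close> into a global
    one; local index 0 becomes the merged rectangle for the colour of \<open>p\<close>.\<close>
  define idx where "idx p q l = (if l = 0 then (0, col p) else (blk q, l))" for p q and l :: nat
  have rect_iff: "e \<in> I \<and> (p, q) \<in> rows e \<times> cols e \<longleftrightarrow> (\<exists>l. l \<in> K q \<and> hit p q l \<and> e = idx p q l)"
    if pq: "p < N" "q < N" for p q e
  proof -
    obtain i k where e: "e = (i, k)" by fastforce
    have q: "blk q \<in> {1..m}" using pos[OF pq(2)] by blast
    \<comment> \<open>Colour 0 thus needs no merged rectangle, so \<open>R\<close> of them suffice
      instead of \<open>R + 1\<close>.\<close>
    then have "C (blk q) 0 = {}"
      using nice unfolding nice_def by blast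
    then have pos_col: "col p \<in> {1..R}" if "off q \<in> C (blk q) (col p)"
      using that col_le[OF pq(1)] by (cases "col p = 0") auto
    show ?thesis
    proof (cases "i = 0")
      case True
      have "(\<exists>l. l \<in> K q \<and> hit p q l \<and> e = idx p q l) \<longleftrightarrow> hit p q 0 \<and> k = col p"
        using q unfolding e True idx_def K_def by auto
      also have "\<dots> \<longleftrightarrow> k \<in> {1..R} \<and> col p = k \<and> off q \<in> C (blk q) k"
        using pos_col unfolding hit_def by (simp only: if_True simp_thms) blast
      also have "\<dots> \<longleftrightarrow> e \<in> I \<and> (p, q) \<in> rows e \<times> cols e"
        using pq unfolding e True I_def rows_def cols_def by simp
      finally show ?thesis by (rule sym)
    next
      case False
      \<comment> \<open>Local index 0 is excluded here, since its image has first component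
        0.\<close>
      then have "e = idx p q l \<longleftrightarrow> i = blk q \<and> l = k \<and> k \<noteq> 0" for l
        unfolding e idx_def by (cases "l = 0") auto
      then have "(\<exists>l. l \<in> K q \<and> hit p q l \<and> e = idx p q l) \<longleftrightarrow>
          k \<in> K q \<and> hit p q k \<and> i = blk q \<and> k \<noteq> 0"
        by (simp only:) blast
      also have "\<dots> \<longleftrightarrow> i = blk q \<and> k \<in> {r i<..t i} \<and> hit p q k"
        unfolding K_def by (cases "i = blk q") auto
      also have "\<dots> \<longleftrightarrow> e \<in> I \<and> (p, q) \<in> rows e \<times> cols e"
      proof (cases "i = blk q \<and> k \<in> {r i<..t i}")
        case True
        then have "k \<noteq> 0" "e \<in> I"
          using q unfolding e I_def by auto
        then show ?thesis
          using pq True False unfolding e rows_def cols_def hit_def by auto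
      next
        case outside: False
        have "k \<in> {r i<..t i}" if "e \<in> I"
          using that False unfolding e I_def by blast
        moreover have "i = blk q" if "q \<in> cols e"
          using that False unfolding e cols_def by simp
        ultimately show ?thesis
          using outside by blast
      qed
      finally show ?thesis by (rule sym)
    qed
  qed
  have "family_partition I (\<lambda>e. rows e \<times> cols e) (ones M)"
    unfolding family_partition_iff
  proof (intro conjI ballI subsetI)
    fix e x assume e: "e \<in> I" "x \<in> rows e \<times> cols e"
    obtain p q where x: "x = (p, q)" by fastforce
    have pq: "p < N" "q < N"
      using e(2) unfolding x rows_def cols_def by (auto split: prod.splits)
    then show "x \<in> ones M"
      using e rect_iff[OF pq, of e] hit_one[OF pq] by (auto simp: x ones_def dims)
  next
    fix x assume "x \<in> ones M"
    then obtain p q where x: "x = (p, q)" and pq: "p < N" "q < N" "M $$ (p, q) = 1"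
      by (auto simp: ones_def dims)
    \<comment> \<open>The unique \<open>e\<close> is the image under \<open>idx p q\<close> of the
      unique local index \<open>l\<close>.\<close>
    show "\<exists>!e. e \<in> I \<and> x \<in> rows e \<times> cols e"
      using hit_unique[OF pq] unfolding x rect_iff[OF pq(1,2)] by blast
  qed
  moreover have "rows e \<subseteq> {..<dim_row M} \<and> cols e \<subseteq> {..<dim_col M}" for e
    unfolding rows_def cols_def dims by (auto split: prod.splits)
  moreover have "finite I"
    unfolding I_def by auto
  ultimately have "rank_bin M \<le> card I"
    using rank_bin_le_card by blast
  \<comment> \<open>The two parts are disjoint because their first components are 0 and at least 1,
    respectively.\<close>
  also have "card I = card ({0::nat} \<times> {1..R}) + card (SIGMA i:{1..m}. {r i<..t i})"
    unfolding I_def by (rule card_Un_disjoint) auto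
  also have "\<dots> = (\<Sum>i\<in>{1..m}. t i - r i) + Max (r ` {1..m})"
    by (simp add: R_def card_cartesian_product)
  finally show ?thesis .
qed

end
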